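(* Let $(X,V,W,S,\mathcal H_*,h,*,\Theta)$ satisfy the abstract symmetrization framework described in the context, with $X$ a Hilbert space. Assume that $f:X\to\mathbb R$ is a lower semi-continuous functional bounded from below such that: (i) $f(u^H)\le f(u)$ for all $u\in S$ and $H\in\mathcal H_*$; (ii) to every $u\in X$ one can associate $\xi\in S$ such that $f(\xi)\le f(u)$, in such a way that (iii) if $(u_h)\subset X$ is bounded, then the sequence $(\xi_h)\subset S$ of the elements associated with $u_h$ is bounded; (iv) $\|u^H\|\le\|u\|$ for all $u\in S$ and $H\in\mathcal H_*$; (v) $f$ admits a bounded minimizing sequence. Then $f$ admits a $(SQPS)_{\inf f}$-sequence.
   Context: Abstract framework. $X,V,W$ are real Banach spaces with $X\subseteq V\subseteq W$, $X$ continuously embedded in $V$ and $V$ continuously embedded in $W$; $\|\cdot\|$ is the norm of $X$. $S\subseteq X$ carries the metric induced by $\|\cdot\|$, $\mathcal H_*$ is a path-connected topological space, and there are maps $*:S\to S$, $u\mapsto u^*$ (symmetrization) and $h:S\times\mathcal H_*\to S$, $(u,H)\mapsto u^H$ (polarization) such that: $h$ is continuous; $(u^* )^H=(u^H)^*=u^*$ and $(u^H)^H=u^H$ for all $u\in S$, $H\in\mathcal H_*$; there is a sequence $(H_m)\subset\mathcal H_*$ such that for every $u\in S$ the iterated polarizations $u^{H_1\cdots H_m}$ converge to $u^*$ in $V$ as $m\to\infty$; $\|u^H-v^H\|_V\le\|u-v\|_V$ for all $u,v\in S$, $H\in\mathcal H_*$. Moreover $\Theta:(X,\|\cdot\|_V)\to(S,\|\cdot\|_V)$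 is Lipschitz with constant $C_\Theta>0$ and $\Theta|_S=\mathrm{Id}|_S$; for $u\in X$ one sets $u^H:=(\Theta(u))^H$ and $u^*:=(\Theta(u))^*$. Weak slope. For $u\in X$ with $f(u)\in\mathbb R$, $|df|(u)$ is the supremum of the $\sigma\in[0,\infty)$ such that there exist $\delta>0$ and a continuous map $\mathcal H:\big(B((u,f(u)),\delta)\cap\mathrm{epi}(f)\big)\times[0,\delta]\to X$ satisfying, for all $(\xi,\mu)\in B((u,f(u)),\delta)\cap\mathrm{epi}(f)$ and $t\in[0,\delta]$, $\|\mathcal H((\xi,\mu),t)-\xi\|\le t$ and $f(\mathcal H((\xi,\mu),t))\le f(\xi)-\sigma t$. Here $\mathrm{epi}(f)=\{(u,\lambda)\in X\times\mathbb R: f(u)\le\lambda\}$ and $B$ denotes open balls. For $u,w\in X$, $Q_u(w):=\limsup_{z\to u,\ \zeta\to w,\ t\to0}\dfrac{f(z+t\zeta)+f(z-t\zeta)-2f(z)}{t^2}\in[-\infty,+\infty]$. A sequence $(u_h)\subset X$ is a symmetric quasi-convex Palais-Smale sequence at level $c\in\mathbb R$ ($(SQPS)_c$-sequence) if $f(u_h)\to c$, $|df|(u_h)\to0$, $\|u_h-u_h^*\|_V\to0$ and $\liminf_{h\to\infty}Q_{u_h}(w)\ge0$ for every $w\in X$. *)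

theory Defs
  imports "HOL-Analysis.Analysis"
begin

text \<open>
  Inclusions of Banach spaces \<open>X \<subseteq> V \<subseteq> W\<close> are rendered as injective bounded linear maps
  \<open>\<iota> : X \<rightarrow> V\<close> and \<open>\<kappa> : V \<rightarrow> W\<close>, so that the \<open>V\<close>-norm of \<open>x \<in> X\<close> is \<open>norm (\<iota> x)\<close>.
\<close>

definition continuous_embedding ::
  "('a::real_normed_vector \<Rightarrow> 'b::real_normed_vector) \<Rightarrow> bool" where
  "continuous_embedding e \<longleftrightarrow> bounded_linear e \<and> inj e"

text \<open>\<open>iterated_pol pol Hs m u\<close> is \<open>((u\<^bsup>H\<^sub>1\<^esup>)\<^bsup>H\<^sub>2\<^esup> \<dots>)\<^bsup>H\<^sub>m\<^esup>\<close> where \<open>H\<^sub>k\<close> is \<open>Hs (k - 1)\<close>.\<close>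

primrec iterated_pol :: "('x \<Rightarrow> 'h \<Rightarrow> 'x) \<Rightarrow> (nat \<Rightarrow> 'h) \<Rightarrow> nat \<Rightarrow> 'x \<Rightarrow> 'x" where
  "iterated_pol pol Hs 0 u = u"
| "iterated_pol pol Hs (Suc m) u = pol (iterated_pol pol Hs m u) (Hs m)"

text \<open>
  Only the values of \<open>pol\<close> on \<open>S \<times> topspace \<H>\<close> and of \<open>symm\<close> on \<open>S\<close> are meaningful; the
  extensions to all of \<open>X\<close> are \<open>u\<^sup>H = pol (\<Theta> u) H\<close> and \<open>u\<^sup>* = symm (\<Theta> u)\<close>.
\<close>

locale symmetrization_framework =
  fixes \<iota> :: "'x::banach \<Rightarrow> 'v::banach"
    and \<kappa> :: "'v \<Rightarrow> 'w::banach"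
    and S :: "'x set"
    and \<H> :: "'h topology"
    and pol :: "'x \<Rightarrow> 'h \<Rightarrow> 'x"
    and symm :: "'x \<Rightarrow> 'x"
    and \<Theta> :: "'x \<Rightarrow> 'x"
    and C\<^sub>\<Theta> :: real
  assumes emb_XV: "continuous_embedding \<iota>"
    and emb_VW: "continuous_embedding \<kappa>"
    and path_connected: "path_connected_space \<H>"
    and sym_mem: "u \<in> S \<Longrightarrow> symm u \<in> S"
    and pol_mem: "u \<in> S \<Longrightarrow> H \<in> topspace \<H> \<Longrightarrow> pol u H \<in> S"
    and pol_continuous:
      "continuous_map (prod_topology (top_of_set S) \<H>) (top_of_set S) (\<lambda>(u, H). pol u H)"
    and pol_sym: "u \<in> S \<Longrightarrow> H \<in> topspace \<H> \<Longrightarrow> pol (symm u) H = symm u"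
    and sym_pol: "u \<in> S \<Longrightarrow> H \<in> topspace \<H> \<Longrightarrow> symm (pol u H) = symm u"
    and pol_pol: "u \<in> S \<Longrightarrow> H \<in> topspace \<H> \<Longrightarrow> pol (pol u H) H = pol u H"
    and approximation:
      "\<exists>Hs :: nat \<Rightarrow> 'h. range Hs \<subseteq> topspace \<H> \<and>
         (\<forall>u\<in>S. (\<lambda>m. \<iota> (iterated_pol pol Hs m u)) \<longlonglongrightarrow> \<iota> (symm u))"
    and pol_contraction:
      "u \<in> S \<Longrightarrow> v \<in> S \<Longrightarrow> H \<in> topspace \<H> \<Longrightarrow>
         norm (\<iota> (pol u H) - \<iota> (pol v H)) \<le> norm (\<iota> u - \<iota> v)"
    and \<Theta>_mem: "\<Theta> u \<in> S"
    and C\<^sub>\<Theta>_pos: "C\<^sub>\<Theta> > 0"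
    and \<Theta>_lipschitz: "norm (\<iota> (\<Theta> u) - \<iota> (\<Theta> v)) \<le> C\<^sub>\<Theta> * norm (\<iota> u - \<iota> v)"
    and \<Theta>_id: "u \<in> S \<Longrightarrow> \<Theta> u = u"

definition lower_semicontinuous :: "('x::topological_space \<Rightarrow> real) \<Rightarrow> bool" where
  "lower_semicontinuous f \<longleftrightarrow> (\<forall>u c. c < f u \<longrightarrow> (\<forall>\<^sub>F v in nhds u. c < f v))"

text \<open>
  Balls in \<open>X \<times> \<real>\<close> are taken in the Euclidean product metric. The set of admissible \<open>\<sigma>\<close>
  always contains \<open>0\<close>; the supremum may be \<open>\<infinity>\<close>.
\<close>

definition weak_slope :: "('x::real_normed_vector \<Rightarrow> real) \<Rightarrow> 'x \<Rightarrow> ereal" where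
  "weak_slope f u = Sup (ereal ` {\<sigma>. 0 \<le> \<sigma> \<and>
     (\<exists>\<delta>>0. \<exists>\<eta> :: ('x \<times> real) \<times> real \<Rightarrow> 'x.
        continuous_on ((ball (u, f u) \<delta> \<inter> epigraph UNIV f) \<times> {0..\<delta>}) \<eta> \<and>
        (\<forall>(\<xi>, \<mu>) \<in> ball (u, f u) \<delta> \<inter> epigraph UNIV f. \<forall>t\<in>{0..\<delta>}.
           norm (\<eta> ((\<xi>, \<mu>), t) - \<xi>) \<le> t \<and> f (\<eta> ((\<xi>, \<mu>), t)) \<le> f \<xi> - \<sigma> * t))})"

text \<open>In the upper limit \<open>z = u\<close> and \<open>\<zeta> = w\<close> are allowed, whereas \<open>t \<noteq> 0\<close>.\<close>

definition Q :: "('x::real_normed_vector \<Rightarrow> real) \<Rightarrow> 'x \<Rightarrow> 'x \<Rightarrow> ereal" where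
  "Q f u w = Limsup (nhds u \<times>\<^sub>F nhds w \<times>\<^sub>F at (0::real))
     (\<lambda>(z, \<zeta>, t). ereal ((f (z + t *\<^sub>R \<zeta>) + f (z - t *\<^sub>R \<zeta>) - 2 * f z) / t\<^sup>2))"

text \<open>\<open>(SQPS)\<^sub>c\<close>-sequences, with \<open>u\<^sup>* = symm (\<Theta> u)\<close>.\<close>

definition SQPS_sequence ::
  "('x::real_normed_vector \<Rightarrow> 'v::real_normed_vector) \<Rightarrow> ('x \<Rightarrow> 'x) \<Rightarrow> ('x \<Rightarrow> 'x) \<Rightarrow>
     ('x \<Rightarrow> real) \<Rightarrow> real \<Rightarrow> (nat \<Rightarrow> 'x) \<Rightarrow> bool" where
  "SQPS_sequence \<iota> symm \<Theta> f c u \<longleftrightarrow>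
     (\<lambda>n. f (u n)) \<longlonglongrightarrow> c \<and>
     (\<lambda>n. weak_slope f (u n)) \<longlonglongrightarrow> 0 \<and>
     (\<lambda>n. norm (\<iota> (u n) - \<iota> (symm (\<Theta> (u n))))) \<longlonglongrightarrow> 0 \<and>
     (\<forall>w. liminf (\<lambda>n. Q f (u n) w) \<ge> 0)"

end

theory Submission
  imports Defs
begin

text \<open>
  Polarizing an almost minimizer in \<open>S\<close> often enough gives an almost minimizer \<open>v \<in> S\<close> that is
  close in \<open>V\<close> to \<open>v\<^sup>*\<close>. The Borwein-Preiss variational principle with quadratic penalties
  moves \<open>v\<close> slightly to a point \<open>w\<close> at which \<open>f\<close> is supported from below by a concave paraboloid of
  small curvature \<open>c\<close> and small slope \<open>p\<close>. The slope bounds the weak slope of \<open>f\<close> at \<open>w\<close>, the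
  curvature bounds \<open>Q\<close> from below, and almost symmetry survives the move because \<open>\<Theta>\<close> and the
  symmetrization, a pointwise limit of \<open>V\<close>-contractions, are Lipschitz in \<open>V\<close>.
\<close>

subsection \<open>The variational principle\<close>

text \<open>If \<open>x\<close> is itself \<open>e\<close>-minimal, take \<open>x' = x\<close>;
  otherwise every point with value below the infimum plus \<open>e\<close> already lies below
  \<open>g x\<close>. Not exceeding \<open>g x\<close> is what makes the penalized values decrease
  in the construction below.\<close>

lemma near_minimizer_below:
  fixes g :: "'a \<Rightarrow> real"
  assumes "bdd_below (range g)" and "e > 0"
  shows "\<exists>x'. g x' \<le> g x \<and> (\<forall>y. g x' \<le> g y + e)"
proof (cases "g x \<le> Inf (range g) + e")
  case True
  have "Inf (range g) \<le> g y" for y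
    using assms(1) by (simp add: cInf_lower)
  then show ?thesis
    using True by (meson add_right_mono order_refl order_trans)
next
  case False
  have "Inf (range g) < Inf (range g) + e" using assms by simp
  then obtain x' where x': "g x' < Inf (range g) + e"
    using cInf_lessD[of "range g"] by (metis UNIV_not_empty image_is_empty rangeE)
  have "Inf (range g) \<le> g y" for y
    using assms(1) by (simp add: cInf_lower)
  then show ?thesis
    using False x' by (meson add_right_mono less_imp_le linear order_trans)
qed

text \<open>Every \<open>a < f w\<close> is eventually below \<open>f (x k)\<close>, hence below
  \<open>b k\<close> and, in the limit, at most \<open>B\<close>. The bound may vary with
  \<open>k\<close> because the penalties it will contain depend on the moving point.\<close>

lemma lower_semicontinuous_le_LIMSEQ:
  fixes f :: "'a::topological_space \<Rightarrow> real"
  assumes "lower_semicontinuous f" and "x \<longlonglongrightarrow> w" and "b \<longlonglongrightarrow> B"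
    and "\<forall>\<^sub>F k in sequentially. f (x k) \<le> b k"
  shows "f w \<le> B"
proof (rule dense_le)
  fix a assume "a < f w"
  then have "\<forall>\<^sub>F v in nhds w. a < f v"
    using assms(1) unfolding lower_semicontinuous_def by blast
  then have "\<forall>\<^sub>F k in sequentially. a < f (x k)"
    using assms(2) unfolding filterlim_iff by blast
  then have "\<forall>\<^sub>F k in sequentially. a \<le> b k"
    using assms(4) by eventually_elim simp
  then show "a \<le> B"
    using assms(3) by (intro tendsto_lowerbound) auto
qed

text \<open>Each stage adds to the current function a penalty centred at the current point and picks
  a new near minimizer. The new penalty vanishes at its centre, so the penalized values can be kept
  from increasing.\<close>

lemma penalized_minimizing_sequence:
  fixes f :: "'x::real_normed_vector \<Rightarrow> real"
  assumes bdd: "bdd_below (range f)"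
    and a: "\<And>n. a n > 0" and e: "\<And>n::nat. e n > 0"
    and v: "\<And>y. f v \<le> f y + e 0"
  obtains x where "x 0 = v"
    and "\<And>n y. f (x n) + (\<Sum>k<n. a k * (norm (x n - x k))\<^sup>2)
           \<le> f y + (\<Sum>k<n. a k * (norm (y - x k))\<^sup>2) + e n"
    and "\<And>n m. n \<le> m \<Longrightarrow> f (x m) + (\<Sum>k<m. a k * (norm (x m - x k))\<^sup>2)
           \<le> f (x n) + (\<Sum>k<n. a k * (norm (x n - x k))\<^sup>2)"
proof -
  obtain L where L: "\<And>y. L \<le> f y"
    using bdd unfolding bdd_below_def by blast
  \<comment> \<open>The state pairs the point with the whole penalized function, so one step of
    dependent choice needs no access to earlier points. The closed form of the function is recovered
    afterwards by induction.\<close>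
  define P where "P n s \<longleftrightarrow> (\<forall>y. L \<le> snd s y) \<and> (\<forall>y. snd s (fst s) \<le> snd s y + e n) \<and>
      (n = 0 \<longrightarrow> s = (v, f))" for n :: nat and s :: "'x \<times> ('x \<Rightarrow> real)"
  define R where "R n s s' \<longleftrightarrow> snd s' = (\<lambda>y. snd s y + a n * (norm (y - fst s))\<^sup>2) \<and>
      snd s' (fst s') \<le> snd s (fst s)" for n :: nat and s s' :: "'x \<times> ('x \<Rightarrow> real)"
  have "\<exists>s. \<forall>n. P n (s n) \<and> R n (s n) (s (Suc n))"
  proof (rule dependent_nat_choice)
    show "\<exists>s. P 0 s"
      using L v by (intro exI[of _ "(v, f)"]) (simp add: P_def)
  next
    fix s n assume s: "P n s"
    define g where "g = (\<lambda>y. snd s y + a n * (norm (y - fst s))\<^sup>2)"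
    have Lg: "L \<le> g y" for y
      using s a[of n] unfolding P_def g_def by (simp add: add_increasing2)
    then have "bdd_below (range g)" by (intro bdd_belowI[of _ L]) auto
    then obtain x' where x': "g x' \<le> g (fst s)" "\<And>y. g x' \<le> g y + e (Suc n)"
      using near_minimizer_below[of g "e (Suc n)" "fst s"] e by blast
    \<comment> \<open>Here \<open>g (fst s) = snd s (fst s)\<close>, since the added penalty is
      centred at \<open>fst s\<close>.\<close>
    have "P (Suc n) (x', g) \<and> R n s (x', g)"
      using Lg x' by (simp add: P_def R_def g_def)
    then show "\<exists>s'. P (Suc n) s' \<and> R n s s'" by blast
  qed
  then obtain s where s: "\<And>n. P n (s n)" "\<And>n. R n (s n) (s (Suc n))" by blast
  define x where "x n = fst (s n)" for n
  have g: "snd (s n) = (\<lambda>y. f y + (\<Sum>k<n. a k * (norm (y - x k))\<^sup>2))" for n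
  proof (induction n)
    case 0
    show ?case using s(1)[of 0] by (simp add: P_def)
  next
    case (Suc n)
    then show ?case using s(2)[of n] by (simp add: R_def x_def add.assoc)
  qed
  show thesis
  proof (rule that[of x])
    show "x 0 = v" using s(1)[of 0] by (simp add: P_def x_def)
    show "f (x n) + (\<Sum>k<n. a k * (norm (x n - x k))\<^sup>2)
           \<le> f y + (\<Sum>k<n. a k * (norm (y - x k))\<^sup>2) + e n" for n y
      using s(1)[of n] unfolding P_def g x_def[symmetric] by blast
    have "f (x (Suc n)) + (\<Sum>k<Suc n. a k * (norm (x (Suc n) - x k))\<^sup>2)
           \<le> f (x n) + (\<Sum>k<n. a k * (norm (x n - x k))\<^sup>2)" for n
      using s(2)[of n] unfolding R_def g x_def[symmetric] by blast
    then show "f (x m) + (\<Sum>k<m. a k * (norm (x m - x k))\<^sup>2)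
           \<le> f (x n) + (\<Sum>k<n. a k * (norm (x n - x k))\<^sup>2)" if "n \<le> m" for n m
      using lift_Suc_antimono_le[of "\<lambda>n. f (x n) + (\<Sum>k<n. a k * (norm (x n - x k))\<^sup>2)"] that
      by blast
  qed
qed

lemma sum_half_powers: "(\<Sum>k<n. (1/2::real) ^ Suc k) = 1 - (1/2) ^ n"
  by (induction n) (simp_all add: field_simps)

text \<open>The limit \<open>w\<close> of the penalized sequence minimizes \<open>f\<close> plus the
  full penalty series. In an inner product space each quadratic penalty expands exactly about
  \<open>w\<close>, so the whole series collapses to a constant, one quadratic term and one linear
  term, whose coefficient is \<open>p\<close>.\<close>

theorem quadratic_variational_principle:
  fixes f :: "'x::{real_inner, banach} \<Rightarrow> real"
  assumes lsc: "lower_semicontinuous f" and bdd: "bdd_below (range f)"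
    and c: "c > 0" and l: "l > 0"
    and v: "\<And>y. f v \<le> f y + c * l\<^sup>2 / 2"
  obtains w p where "norm (w - v) \<le> l" and "f w \<le> f v" and "norm p \<le> 2 * c * l"
    and "\<And>y. f w \<le> f y + c * (norm (y - w))\<^sup>2 + inner p (y - w)"
proof -
  \<comment> \<open>The weights sum to \<open>c\<close>. The errors satisfy
    \<open>e n = a n * (l * (1/2) ^ n)\<^sup>2\<close>, which forces geometric decay of the steps,
    and \<open>e 0\<close> is exactly the accuracy assumed of \<open>v\<close>.\<close>
  define a where "a n = c * (1/2) ^ Suc n" for n
  define e where "e n = c * l\<^sup>2 / 2 * (1/8) ^ n" for n :: nat
  have a_pos: "a n > 0" and e_pos: "e n > 0" for n
    using c l by (simp_all add: a_def e_def)
  have v0: "f v \<le> f y + e 0" for y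
    using v by (simp add: e_def)
  obtain x where x0: "x 0 = v"
    and near: "\<And>n y. f (x n) + (\<Sum>k<n. a k * (norm (x n - x k))\<^sup>2)
           \<le> f y + (\<Sum>k<n. a k * (norm (y - x k))\<^sup>2) + e n"
    and decr: "\<And>n m. n \<le> m \<Longrightarrow> f (x m) + (\<Sum>k<m. a k * (norm (x m - x k))\<^sup>2)
           \<le> f (x n) + (\<Sum>k<n. a k * (norm (x n - x k))\<^sup>2)"
    by (rule penalized_minimizing_sequence[of f a e v, OF bdd a_pos e_pos v0]) blast
  have penalty_mono: "(\<Sum>k<n. a k * (norm (y - x k))\<^sup>2) \<le> (\<Sum>k<m. a k * (norm (y - x k))\<^sup>2)"
    if "n \<le> m" for n m y
    using that a_pos by (intro sum_mono2) (auto simp: less_imp_le)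
  \<comment> \<open>The penalty centred at \<open>x n\<close> enters only after stage
    \<open>n\<close>, hence the separate case \<open>n = m\<close>. For \<open>m > n\<close>,
    monotonicity and near minimality of \<open>x n\<close>, tested at \<open>x m\<close>, leave only
    that penalty, bounded by \<open>e n\<close>.\<close>
  have near_tail: "norm (x m - x n) \<le> l * (1/2) ^ n" if "n \<le> m" for n m
  proof (cases "n = m")
    case False
    then have "Suc n \<le> m" using that by simp
    then have "f (x m) + (\<Sum>k<Suc n. a k * (norm (x m - x k))\<^sup>2)
        \<le> f (x n) + (\<Sum>k<n. a k * (norm (x n - x k))\<^sup>2)"
      using penalty_mono[of "Suc n" m "x m"] decr[OF that] by linarith
    also have "\<dots> \<le> f (x m) + (\<Sum>k<n. a k * (norm (x m - x k))\<^sup>2) + e n"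
      by (rule near)
    finally have "a n * (norm (x m - x n))\<^sup>2 \<le> e n" by simp
    also have "e n = a n * (l * (1/2) ^ n)\<^sup>2"
    proof -
      have "(1/8::real) ^ n = (1/2) ^ n * ((1/2) ^ n)\<^sup>2"
        by (simp add: power2_eq_square flip: power_mult_distrib)
      then show ?thesis
        by (simp add: e_def a_def power_mult_distrib)
    qed
    finally have "(norm (x m - x n))\<^sup>2 \<le> (l * (1/2) ^ n)\<^sup>2"
      using a_pos[of n] by simp
    then show ?thesis
      using l by (simp add: power2_le_iff_abs_le)
  qed (use l in simp)
  have lim0: "(\<lambda>n. l * (1/2) ^ n) \<longlonglongrightarrow> 0"
    by (intro tendsto_mult_right_zero LIMSEQ_realpow_zero) auto
  have "Cauchy x"
  proof (rule CauchyI)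
    fix r :: real assume "r > 0"
    then have "\<forall>\<^sub>F n in sequentially. l * (1/2) ^ n < r / 2"
      using lim0 by (intro order_tendstoD(2)) auto
    then obtain N where N: "l * (1/2) ^ N < r / 2"
      by (auto simp: eventually_sequentially)
    have "norm (x m - x n) < r" if "m \<ge> N" "n \<ge> N" for m n
    proof -
      have "norm (x m - x n) \<le> norm (x m - x N) + norm (x n - x N)"
        by norm
      also have "\<dots> < r"
        using near_tail[OF that(1)] near_tail[OF that(2)] N by linarith
      finally show ?thesis .
    qed
    then show "\<exists>M. \<forall>m\<ge>M. \<forall>n\<ge>M. norm (x m - x n) < r" by blast
  qed
  then obtain w where w: "x \<longlonglongrightarrow> w"
    using Cauchy_convergent convergent_def by blast
  have w_near: "norm (w - x n) \<le> l" for n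
  proof -
    have "norm (w - x n) \<le> l * (1/2) ^ n"
      using near_tail w by (intro tendsto_upperbound[OF tendsto_norm[OF tendsto_diff[OF w tendsto_const]]])
        (auto simp: eventually_sequentially)
    also have "\<dots> \<le> l" using l by (simp add: power_le_one)
    finally show ?thesis .
  qed
  \<comment> \<open>With \<open>n\<close> fixed, the penalties of index at least \<open>n\<close>
    are dropped from the value at stage \<open>m\<close>. What remains is a continuous finite sum,
    so lower semicontinuity applies as \<open>m\<close> tends to infinity.\<close>
  have w_below: "f w \<le> f (x n) + (\<Sum>k<n. a k * (norm (x n - x k))\<^sup>2)
      - (\<Sum>k<n. a k * (norm (w - x k))\<^sup>2)" for n
  proof (rule lower_semicontinuous_le_LIMSEQ[OF lsc w])
    show "(\<lambda>m. f (x n) + (\<Sum>k<n. a k * (norm (x n - x k))\<^sup>2)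
        - (\<Sum>k<n. a k * (norm (x m - x k))\<^sup>2)) \<longlonglongrightarrow>
      f (x n) + (\<Sum>k<n. a k * (norm (x n - x k))\<^sup>2) - (\<Sum>k<n. a k * (norm (w - x k))\<^sup>2)"
      by (intro tendsto_intros w)
    have "f (x m) \<le> f (x n) + (\<Sum>k<n. a k * (norm (x n - x k))\<^sup>2)
        - (\<Sum>k<n. a k * (norm (x m - x k))\<^sup>2)" if "n \<le> m" for m
      using decr[OF that] penalty_mono[OF that, of "x m"] by linarith
    then show "\<forall>\<^sub>F m in sequentially. f (x m) \<le> f (x n) + (\<Sum>k<n. a k * (norm (x n - x k))\<^sup>2)
        - (\<Sum>k<n. a k * (norm (x m - x k))\<^sup>2)"
      by (auto simp: eventually_sequentially)
  qed
  \<comment> \<open>This is the gradient at \<open>w\<close> of the penalty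
    \<open>a k * (norm (y - x k))\<^sup>2\<close>. The gradients are dominated by a geometric series
    with sum \<open>2 * c * l\<close>; their sum is the slope \<open>p\<close>.\<close>
  define q where "q k = (2 * a k) *\<^sub>R (w - x k)" for k
  have q_norm: "norm (q k) \<le> 2 * c * l * (1/2) ^ Suc k" for k
  proof -
    have "norm (q k) = 2 * a k * norm (w - x k)"
      using a_pos[of k] by (simp add: q_def)
    also have "\<dots> \<le> 2 * a k * l"
      using a_pos[of k] w_near[of k] by (intro mult_left_mono) auto
    finally show ?thesis by (simp add: a_def mult_ac)
  qed
  have "summable (\<lambda>k. 2 * c * l * (1/2::real) ^ Suc k)"
    by (intro summable_mult summable_Suc_iff[THEN iffD2] summable_geometric) simp
  then have "summable q"
    by (rule summable_comparison_test') (rule q_norm)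
  then have q_lim: "(\<lambda>n. \<Sum>k<n. q k) \<longlonglongrightarrow> suminf q"
    by (rule summable_LIMSEQ)
  have "norm (\<Sum>k<n. q k) \<le> 2 * c * l" for n
  proof -
    have "norm (\<Sum>k<n. q k) \<le> (\<Sum>k<n. 2 * c * l * (1/2) ^ Suc k)"
      by (rule sum_norm_le) (rule q_norm)
    also have "\<dots> = 2 * c * l * (1 - (1/2) ^ n)"
      by (simp only: sum_half_powers flip: sum_distrib_left)
    also have "\<dots> \<le> 2 * c * l * 1"
      using c l by (intro mult_left_mono) auto
    finally show ?thesis by simp
  qed
  then have p_norm: "norm (suminf q) \<le> 2 * c * l"
    by (intro tendsto_upperbound[OF tendsto_norm[OF q_lim]]) auto
  have supp: "f w \<le> f y + c * (norm (y - w))\<^sup>2 + inner (suminf q) (y - w)" for y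
  proof (rule LIMSEQ_le_const)
    have "(\<lambda>n. (1/8::real) ^ n) \<longlonglongrightarrow> 0"
      by (rule LIMSEQ_realpow_zero) auto
    then have "e \<longlonglongrightarrow> 0"
      unfolding e_def by (rule tendsto_mult_right_zero)
    then have "(\<lambda>n. f y + c * (norm (y - w))\<^sup>2 + inner (\<Sum>k<n. q k) (y - w) + e n) \<longlonglongrightarrow>
        f y + c * (norm (y - w))\<^sup>2 + inner (suminf q) (y - w) + 0"
      by (intro tendsto_intros q_lim)
    then show "(\<lambda>n. f y + c * (norm (y - w))\<^sup>2 + inner (\<Sum>k<n. q k) (y - w) + e n) \<longlonglongrightarrow>
        f y + c * (norm (y - w))\<^sup>2 + inner (suminf q) (y - w)" by simp
    have "f w \<le> f y + c * (norm (y - w))\<^sup>2 + inner (\<Sum>k<n. q k) (y - w) + e n" for n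
    proof -
      have "a k * (norm (y - x k))\<^sup>2 = a k * (norm (w - x k))\<^sup>2 + a k * (norm (y - w))\<^sup>2
          + inner (q k) (y - w)" for k
        unfolding q_def power2_norm_eq_inner
        by (simp add: inner_diff_left inner_diff_right inner_commute algebra_simps)
      then have "(\<Sum>k<n. a k * (norm (y - x k))\<^sup>2) = (\<Sum>k<n. a k * (norm (w - x k))\<^sup>2)
          + (\<Sum>k<n. a k) * (norm (y - w))\<^sup>2 + inner (\<Sum>k<n. q k) (y - w)"
        by (simp add: sum.distrib sum_distrib_right inner_sum_left)
      moreover have "(\<Sum>k<n. a k) \<le> c"
        using c unfolding a_def by (simp only: sum_half_powers flip: sum_distrib_left) simp
      then have "(\<Sum>k<n. a k) * (norm (y - w))\<^sup>2 \<le> c * (norm (y - w))\<^sup>2"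
        by (rule mult_right_mono) simp
      \<comment> \<open>The \<open>n\<close>-th penalized function at \<open>w\<close> is at most
        its value at \<open>x n\<close>, which is at most its value at \<open>y\<close> plus
        \<open>e n\<close>. The penalties evaluated at \<open>w\<close> cancel.\<close>
      ultimately show ?thesis
        using w_below[of n] near[of n y] by linarith
    qed
    then show "\<exists>N. \<forall>n\<ge>N. f w \<le> f y + c * (norm (y - w))\<^sup>2 + inner (\<Sum>k<n. q k) (y - w) + e n"
      by blast
  qed
  show thesis
    using that[of w "suminf q"] w_near[of 0] w_below[of 0] p_norm supp x0 by simp
qed

subsection \<open>Consequences of a supporting paraboloid\<close>

text \<open>The deformation that leaves every point fixed shows that \<open>\<sigma> = 0\<close> is
  admissible.\<close>

lemma weak_slope_nonneg: "0 \<le> weak_slope f u"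
proof -
  have "ereal 0 \<le> weak_slope f u"
    unfolding weak_slope_def
    by (intro Sup_upper imageI CollectI conjI exI[of _ "1::real"] exI[of _ "\<lambda>z. fst (fst z)"])
      (auto intro!: continuous_intros)
  then show ?thesis by (simp add: zero_ereal_def)
qed

text \<open>It suffices to test a deformation at \<open>(w, f w)\<close>: within distance
  \<open>t\<close> it lowers \<open>f\<close> by at least \<open>\<sigma> * t\<close>, while the
  paraboloid permits a drop of at most \<open>c * t\<^sup>2 + norm p * t\<close>. Dividing by
  \<open>t\<close> and letting \<open>t\<close> tend to \<open>0\<close> gives the bound.\<close>

lemma weak_slope_le_if_supported:
  fixes f :: "'x::real_inner \<Rightarrow> real"
  assumes c: "c \<ge> 0"
    and supp: "\<And>y. f w \<le> f y + c * (norm (y - w))\<^sup>2 + inner p (y - w)"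
  shows "weak_slope f w \<le> ereal (norm p)"
  unfolding weak_slope_def
proof (rule Sup_least, clarify)
  fix \<sigma> \<delta> :: real and \<eta> :: "('x \<times> real) \<times> real \<Rightarrow> 'x"
  assume "0 \<le> \<sigma>" and \<delta>: "\<delta> > 0"
    and \<eta>: "\<forall>(\<xi>, \<mu>) \<in> ball (w, f w) \<delta> \<inter> epigraph UNIV f. \<forall>t\<in>{0..\<delta>}.
           norm (\<eta> ((\<xi>, \<mu>), t) - \<xi>) \<le> t \<and> f (\<eta> ((\<xi>, \<mu>), t)) \<le> f \<xi> - \<sigma> * t"
  have "\<sigma> \<le> c * t + norm p" if t: "t \<in> {0<..<\<delta>}" for t
  proof -
    define y where "y = \<eta> ((w, f w), t)"
    have y: "norm (y - w) \<le> t" "f y \<le> f w - \<sigma> * t"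
      using \<eta> \<delta> t unfolding y_def by (force simp: epigraph_def)+
    have "inner p (y - w) \<le> norm p * t"
      using norm_cauchy_schwarz[of p "y - w"] mult_left_mono[OF y(1), of "norm p"] by simp
    moreover have "c * (norm (y - w))\<^sup>2 \<le> c * t\<^sup>2"
      using y(1) c by (intro mult_left_mono power_mono) auto
    ultimately have "\<sigma> * t \<le> (c * t + norm p) * t"
      using supp[of y] y(2) by (simp add: algebra_simps power2_eq_square)
    then show ?thesis using t by simp
  qed
  then have "\<forall>\<^sub>F t in at_right 0. \<sigma> \<le> c * t + norm p"
    using \<delta> by (auto simp: eventually_at_right)
  moreover have "((\<lambda>t. c * t + norm p) \<longlongrightarrow> c * 0 + norm p) (at_right 0)"
    by (intro tendsto_intros)
  ultimately show "ereal \<sigma> \<le> ereal (norm p)"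
    using tendsto_lowerbound[of "\<lambda>t. c * t + norm p" "norm p" "at_right 0" \<sigma>] by simp
qed

text \<open>Adding the supporting inequalities at \<open>u + t *\<^sub>R w\<close> and
  \<open>u - t *\<^sub>R w\<close> cancels the linear terms and bounds the second difference
  quotient at \<open>u\<close> in direction \<open>w\<close>.\<close>

lemma Q_ge_if_supported:
  fixes f :: "'x::real_inner \<Rightarrow> real"
  assumes supp: "\<And>y. f u \<le> f y + c * (norm (y - u))\<^sup>2 + inner p (y - u)"
  shows "ereal (- 2 * c * (norm w)\<^sup>2) \<le> Q f u w"
proof -
  let ?q = "\<lambda>(z, \<zeta>, t). ereal ((f (z + t *\<^sub>R \<zeta>) + f (z - t *\<^sub>R \<zeta>) - 2 * f z) / t\<^sup>2)"
  \<comment> \<open>Freezing \<open>z = u\<close> and \<open>\<zeta> = w\<close> gives a finer,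
    still proper filter; its upper limit can only be smaller.\<close>
  let ?F = "filtermap (\<lambda>t::real. (u, w, t)) (at 0)"
  have "filterlim (\<lambda>t::real. (u, w, t)) (nhds u \<times>\<^sub>F nhds w \<times>\<^sub>F at 0) (at 0)"
    by (intro filterlim_Pair tendsto_const filterlim_ident)
  then have F: "?F \<le> nhds u \<times>\<^sub>F nhds w \<times>\<^sub>F at 0"
    by (simp add: filterlim_def)
  have "- 2 * c * (norm w)\<^sup>2 \<le> (f (u + t *\<^sub>R w) + f (u - t *\<^sub>R w) - 2 * f u) / t\<^sup>2"
    if "t \<noteq> 0" for t
  proof -
    have "- 2 * c * (norm w)\<^sup>2 * t\<^sup>2 \<le> f (u + t *\<^sub>R w) + f (u - t *\<^sub>R w) - 2 * f u"
      using supp[of "u + t *\<^sub>R w"] supp[of "u - t *\<^sub>R w"]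
      by (simp add: power_mult_distrib algebra_simps)
    then show ?thesis using that by (simp add: pos_le_divide_eq)
  qed
  then have "\<forall>\<^sub>F z in ?F. ereal (- 2 * c * (norm w)\<^sup>2) \<le> ?q z"
    by (auto simp: eventually_filtermap eventually_at_filter)
  then have "ereal (- 2 * c * (norm w)\<^sup>2) \<le> Limsup ?F ?q"
    by (intro le_Limsup) (auto simp: filtermap_bot_iff)
  also have "\<dots> \<le> Q f u w"
    unfolding Q_def Limsup_def using F
    by (intro INF_superset_mono) (auto simp: le_filter_def)
  finally show ?thesis .
qed

subsection \<open>Almost symmetric points\<close>

context symmetrization_framework
begin

lemma iterated_pol_mem:
  assumes "range Hs \<subseteq> topspace \<H>" and "u \<in> S"
  shows "iterated_pol pol Hs m u \<in> S"
  using assms by (induction m) (auto intro!: pol_mem)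

lemma sym_iterated_pol:
  assumes "range Hs \<subseteq> topspace \<H>" and "u \<in> S"
  shows "symm (iterated_pol pol Hs m u) = symm u"
proof (induction m)
  case (Suc m)
  then show ?case
    using sym_pol[OF iterated_pol_mem[OF assms]] assms(1)
    by (metis iterated_pol.simps(2) range_subsetD)
qed simp

lemma iterated_pol_contraction:
  assumes "range Hs \<subseteq> topspace \<H>" and "u \<in> S" and "v \<in> S"
  shows "norm (\<iota> (iterated_pol pol Hs m u) - \<iota> (iterated_pol pol Hs m v)) \<le> norm (\<iota> u - \<iota> v)"
proof (induction m)
  case (Suc m)
  have "Hs m \<in> topspace \<H>" using assms(1) by blast
  then have "norm (\<iota> (iterated_pol pol Hs (Suc m) u) - \<iota> (iterated_pol pol Hs (Suc m) v))
      \<le> norm (\<iota> (iterated_pol pol Hs m u) - \<iota> (iterated_pol pol Hs m v))"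
    using pol_contraction[OF iterated_pol_mem[OF assms(1,2)] iterated_pol_mem[OF assms(1,3)]]
    by simp
  then show ?case using Suc by linarith
qed simp

text \<open>One sequence of polarizers serves all points of \<open>S\<close>, so the contraction
  estimate for iterated polarizations of \<open>u\<close> and \<open>v\<close> passes to the
  limit.\<close>

lemma sym_contraction:
  assumes "u \<in> S" and "v \<in> S"
  shows "norm (\<iota> (symm u) - \<iota> (symm v)) \<le> norm (\<iota> u - \<iota> v)"
proof -
  obtain Hs where Hs: "range Hs \<subseteq> topspace \<H>"
    and lim: "\<And>u. u \<in> S \<Longrightarrow> (\<lambda>m. \<iota> (iterated_pol pol Hs m u)) \<longlonglongrightarrow> \<iota> (symm u)"
    using approximation by blast
  show ?thesis
    using iterated_pol_contraction[OF Hs assms]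
    by (intro tendsto_upperbound[OF tendsto_norm[OF tendsto_diff[OF lim lim]]] assms) auto
qed

text \<open>Iterated polarizations of \<open>u\<close> do not raise \<open>f\<close> and approach
  \<open>symm u\<close> in the norm of \<open>V\<close>. They all have the symmetrization
  \<open>symm u\<close>, so a late iterate is close to its own symmetrization.\<close>

lemma almost_symmetric_polarization:
  fixes f :: "'x \<Rightarrow> real"
  assumes pol_f: "\<And>u H. u \<in> S \<Longrightarrow> H \<in> topspace \<H> \<Longrightarrow> f (pol u H) \<le> f u"
    and u: "u \<in> S" and r: "r > 0"
  obtains v where "v \<in> S" and "f v \<le> f u" and "norm (\<iota> v - \<iota> (symm v)) < r"
proof -
  obtain Hs where Hs: "range Hs \<subseteq> topspace \<H>"
    and lim: "(\<lambda>m. \<iota> (iterated_pol pol Hs m u)) \<longlonglongrightarrow> \<iota> (symm u)"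
    using approximation u by blast
  have f_le: "f (iterated_pol pol Hs m u) \<le> f u" for m
  proof (induction m)
    case (Suc m)
    have "Hs m \<in> topspace \<H>" using Hs by blast
    then show ?case
      using pol_f[OF iterated_pol_mem[OF Hs u]] Suc by (metis iterated_pol.simps(2) order_trans)
  qed simp
  have "\<forall>\<^sub>F m in sequentially. dist (\<iota> (iterated_pol pol Hs m u)) (\<iota> (symm u)) < r"
    using lim r by (rule tendstoD)
  then obtain m where "dist (\<iota> (iterated_pol pol Hs m u)) (\<iota> (symm u)) < r"
    by (auto simp: eventually_sequentially)
  then show thesis
    using that[OF iterated_pol_mem[OF Hs u] f_le] sym_iterated_pol[OF Hs u]
    by (simp add: dist_norm)
qed

text \<open>The triangle inequality through \<open>v\<close> and \<open>symm v\<close>. As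
  \<open>w\<close> may lie outside \<open>S\<close>, its symmetrization passes through
  \<open>\<Theta>\<close>, which fixes \<open>v\<close> and costs the factor
  \<open>C\<^sub>\<Theta>\<close>.\<close>

lemma asymmetry_le:
  assumes v: "v \<in> S" and B: "\<And>x. norm (\<iota> x) \<le> norm x * B"
  shows "norm (\<iota> w - \<iota> (symm (\<Theta> w)))
    \<le> norm (\<iota> v - \<iota> (symm v)) + (1 + C\<^sub>\<Theta>) * (norm (w - v) * B)"
proof -
  have \<iota>_diff: "norm (\<iota> w - \<iota> v) \<le> norm (w - v) * B"
    using B[of "w - v"] emb_XV
    by (simp add: continuous_embedding_def bounded_linear.linear linear_diff)
  have "norm (\<iota> (symm v) - \<iota> (symm (\<Theta> w))) \<le> norm (\<iota> (\<Theta> v) - \<iota> (\<Theta> w))"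
    using sym_contraction[OF v \<Theta>_mem[of w]] v by (simp add: \<Theta>_id)
  also have "\<dots> \<le> C\<^sub>\<Theta> * norm (\<iota> w - \<iota> v)"
    using \<Theta>_lipschitz[of v w] by (simp add: norm_minus_commute)
  finally have "norm (\<iota> (symm v) - \<iota> (symm (\<Theta> w))) \<le> C\<^sub>\<Theta> * norm (\<iota> w - \<iota> v)" .
  moreover have "norm (\<iota> w - \<iota> (symm (\<Theta> w))) \<le> norm (\<iota> w - \<iota> v)
      + (norm (\<iota> v - \<iota> (symm v)) + norm (\<iota> (symm v) - \<iota> (symm (\<Theta> w))))"
    by norm
  moreover have "(1 + C\<^sub>\<Theta>) * norm (\<iota> w - \<iota> v) \<le> (1 + C\<^sub>\<Theta>) * (norm (w - v) * B)"
    using \<iota>_diff C\<^sub>\<Theta>_pos by (intro mult_left_mono) auto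
  ultimately show ?thesis by (simp add: algebra_simps)
qed

end

section \<open>From approximate points to the sequence\<close>

text \<open>Take \<open>d = inverse (Suc n)\<close>. As \<open>K\<close> does not depend on
  \<open>d\<close>, the first three bounds tend to \<open>0\<close>; the lower bound on
  \<open>Q\<close> does so for each fixed direction.\<close>

lemma SQPS_sequence_if_approximate:
  assumes "\<And>d. d > 0 \<Longrightarrow> \<exists>u. \<bar>f u - c\<bar> \<le> K * d \<and> weak_slope f u \<le> ereal (K * d) \<and>
    norm (\<iota> u - \<iota> (symm (\<Theta> u))) \<le> K * d \<and> (\<forall>w. ereal (- (d * (norm w)\<^sup>2)) \<le> Q f u w)"
  shows "\<exists>u. SQPS_sequence \<iota> symm \<Theta> f c u"
proof -
  have "\<exists>u. \<bar>f u - c\<bar> \<le> K * inverse (Suc n) \<and> weak_slope f u \<le> ereal (K * inverse (Suc n)) \<and>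
    norm (\<iota> u - \<iota> (symm (\<Theta> u))) \<le> K * inverse (Suc n) \<and>
    (\<forall>w. ereal (- (inverse (Suc n) * (norm w)\<^sup>2)) \<le> Q f u w)" for n
    by (rule assms) simp
  then obtain u where u: "\<And>n. \<bar>f (u n) - c\<bar> \<le> K * inverse (Suc n)"
      "\<And>n. weak_slope f (u n) \<le> ereal (K * inverse (Suc n))"
      "\<And>n. norm (\<iota> (u n) - \<iota> (symm (\<Theta> (u n)))) \<le> K * inverse (Suc n)"
      "\<And>n w. ereal (- (inverse (Suc n) * (norm w)\<^sup>2)) \<le> Q f (u n) w"
    by metis
  have K0: "(\<lambda>n. K * inverse (Suc n)) \<longlonglongrightarrow> 0"
    by (intro tendsto_mult_right_zero LIMSEQ_inverse_real_of_nat)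
  have "(\<lambda>n. f (u n) - c) \<longlonglongrightarrow> 0"
    by (rule tendsto_0_le[where K = 1, OF K0]) (use u(1) in \<open>auto intro!: always_eventually intro: order_trans[OF _ abs_ge_self]\<close>)
  then have "(\<lambda>n. f (u n)) \<longlonglongrightarrow> c"
    by (simp add: LIM_zero_iff)
  moreover have "(\<lambda>n. weak_slope f (u n)) \<longlonglongrightarrow> 0"
  proof (rule tendsto_sandwich[OF _ _ tendsto_const])
    show "(\<lambda>n. ereal (K * inverse (Suc n))) \<longlonglongrightarrow> 0"
      using tendsto_ereal[OF K0] by (simp only: zero_ereal_def)
  qed (use u(2) in \<open>simp_all add: weak_slope_nonneg del: of_nat_Suc\<close>)
  moreover have "(\<lambda>n. norm (\<iota> (u n) - \<iota> (symm (\<Theta> (u n))))) \<longlonglongrightarrow> 0"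
    by (rule tendsto_sandwich[OF _ _ tendsto_const K0]) (use u(3) in auto)
  moreover have "liminf (\<lambda>n. Q f (u n) w) \<ge> 0" for w
  proof -
    have "(\<lambda>n. - (inverse (Suc n) * (norm w)\<^sup>2)) \<longlonglongrightarrow> - 0"
      by (intro tendsto_minus tendsto_mult_left_zero LIMSEQ_inverse_real_of_nat)
    then have "(\<lambda>n. ereal (- (inverse (Suc n) * (norm w)\<^sup>2))) \<longlonglongrightarrow> ereal 0"
      by (intro tendsto_ereal) simp
    then have "liminf (\<lambda>n. ereal (- (inverse (Suc n) * (norm w)\<^sup>2))) = 0"
      by (intro lim_imp_Liminf) (auto simp: zero_ereal_def)
    then show ?thesis
      using Liminf_mono[of "\<lambda>n. ereal (- (inverse (Suc n) * (norm w)\<^sup>2))"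
          "\<lambda>n. Q f (u n) w" sequentially] u(4) by auto
  qed
  ultimately show ?thesis
    unfolding SQPS_sequence_def by blast
qed

theorem theorem2p28:
  fixes \<iota> :: "'x::{real_inner, banach} \<Rightarrow> 'v::banach"
    and \<kappa> :: "'v \<Rightarrow> 'w::banach"
    and S :: "'x set"
    and \<H> :: "'h topology"
    and pol :: "'x \<Rightarrow> 'h \<Rightarrow> 'x"
    and symm \<Theta> :: "'x \<Rightarrow> 'x"
    and C\<^sub>\<Theta> :: real
    and f :: "'x \<Rightarrow> real"
  assumes "symmetrization_framework \<iota> \<kappa> S \<H> pol symm \<Theta> C\<^sub>\<Theta>"
    and "lower_semicontinuous f"
    and "bdd_below (range f)"
    and "\<And>u H. u \<in> S \<Longrightarrow> H \<in> topspace \<H> \<Longrightarrow> f (pol u H) \<le> f u"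
    and "\<exists>\<xi> :: 'x \<Rightarrow> 'x. (\<forall>u. \<xi> u \<in> S \<and> f (\<xi> u) \<le> f u) \<and>
           (\<forall>u :: nat \<Rightarrow> 'x. bounded (range u) \<longrightarrow> bounded (range (\<lambda>n. \<xi> (u n))))"
    and "\<And>u H. u \<in> S \<Longrightarrow> H \<in> topspace \<H> \<Longrightarrow> norm (pol u H) \<le> norm u"
    and "\<exists>u :: nat \<Rightarrow> 'x. bounded (range u) \<and> (\<lambda>n. f (u n)) \<longlonglongrightarrow> Inf (range f)"
  shows "\<exists>u :: nat \<Rightarrow> 'x. SQPS_sequence \<iota> symm \<Theta> f (Inf (range f)) u"
proof -
  interpret symmetrization_framework \<iota> \<kappa> S \<H> pol symm \<Theta> C\<^sub>\<Theta> by (rule assms(1))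
  let ?m = "Inf (range f)"
  have inf_le: "?m \<le> f y" for y
    using assms(3) by (simp add: cInf_lower)
  obtain \<xi> where \<xi>: "\<And>u. \<xi> u \<in> S" "\<And>u. f (\<xi> u) \<le> f u"
    using assms(5) by blast
  obtain B where B: "B > 0" "\<And>x. norm (\<iota> x) \<le> norm x * B"
    using emb_XV bounded_linear.pos_bounded unfolding continuous_embedding_def by blast
  \<comment> \<open>The second summand comes from moving an almost symmetric point by
    \<open>l\<close>; the \<open>2\<close> covers the remaining errors.\<close>
  define K where "K = 2 + (1 + C\<^sub>\<Theta>) * B"
  have K: "K \<ge> 2"
    using B(1) C\<^sub>\<Theta>_pos by (simp add: K_def)
  have "\<exists>u. \<bar>f u - ?m\<bar> \<le> K * d \<and> weak_slope f u \<le> ereal (K * d) \<and>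
      norm (\<iota> u - \<iota> (symm (\<Theta> u))) \<le> K * d \<and> (\<forall>w. ereal (- (d * (norm w)\<^sup>2)) \<le> Q f u w)"
    if "d > 0" for d
  proof -
    \<comment> \<open>This number is both the curvature and the radius in the variational principle.
      The bound \<open>2 * l \<le> d\<close> matches the curvature estimate for \<open>Q\<close>,
      and \<open>l \<le> 1\<close> lets powers of \<open>l\<close> be estimated by
      \<open>l\<close>.\<close>
    define l where "l = min (d / 2) 1"
    have l: "l > 0" "l \<le> 1" "2 * l \<le> d"
      using that by (auto simp: l_def)
    have l2: "l * l\<^sup>2 \<le> l" "l * l \<le> l"
      using l power_decreasing[of 1 3 l] by (simp_all add: power2_eq_square power3_eq_cube mult_le_cancel_left1)
    have "?m < ?m + l * l\<^sup>2 / 2" using l(1) by simp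
    then obtain u0 where u0: "f u0 < ?m + l * l\<^sup>2 / 2"
      using cInf_lessD[of "range f"] by (metis UNIV_not_empty image_is_empty rangeE)
    \<comment> \<open>Passing to \<open>\<xi> u0\<close> enters \<open>S\<close> and polarizing
      makes the point almost symmetric. Neither raises \<open>f\<close>, so \<open>v\<close> keeps
      the accuracy \<open>l * l\<^sup>2 / 2\<close> required with curvature and radius
      \<open>l\<close>.\<close>
    obtain v where v: "v \<in> S" "f v \<le> f (\<xi> u0)" "norm (\<iota> v - \<iota> (symm v)) < l"
      using almost_symmetric_polarization[of f "\<xi> u0" l] assms(4) \<xi>(1) l(1) by blast
    have fv: "f v \<le> ?m + l * l\<^sup>2 / 2"
      using v(2) \<xi>(2)[of u0] u0 by linarith
    then have "f v \<le> f y + l * l\<^sup>2 / 2" for y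
      using inf_le[of y] by linarith
    then obtain w p where w: "norm (w - v) \<le> l" "f w \<le> f v" "norm p \<le> 2 * l * l"
      and supp: "\<And>y. f w \<le> f y + l * (norm (y - w))\<^sup>2 + inner p (y - w)"
      using quadratic_variational_principle[OF assms(2,3) l(1) l(1)] by blast
    have Kd: "2 * d \<le> K * d" "K * l \<le> K * d"
      using K that l by (auto intro!: mult_right_mono mult_left_mono)
    have "\<bar>f w - ?m\<bar> \<le> K * d"
      using w(2) fv inf_le[of w] l2 l Kd by linarith
    moreover have "weak_slope f w \<le> ereal (K * d)"
    proof -
      have "weak_slope f w \<le> ereal (norm p)"
        using l by (intro weak_slope_le_if_supported[OF _ supp]) simp
      moreover have "norm p \<le> K * d"
        using w(3) l2 l Kd by linarith
      ultimately show ?thesis by (meson ereal_less_eq(3) order_trans)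
    qed
    moreover have "norm (\<iota> w - \<iota> (symm (\<Theta> w))) \<le> K * d"
    proof -
      have "(1 + C\<^sub>\<Theta>) * (norm (w - v) * B) \<le> (1 + C\<^sub>\<Theta>) * (l * B)"
        using w(1) B(1) C\<^sub>\<Theta>_pos by (intro mult_left_mono mult_right_mono) auto
      then have "norm (\<iota> w - \<iota> (symm (\<Theta> w))) \<le> l + (1 + C\<^sub>\<Theta>) * (l * B)"
        using asymmetry_le[OF v(1) B(2), of w] v(3) by linarith
      also have "\<dots> \<le> K * l"
        using l by (simp add: K_def algebra_simps)
      finally show ?thesis using Kd by linarith
    qed
    moreover have "ereal (- (d * (norm x)\<^sup>2)) \<le> Q f w x" for x
    proof -
      have "ereal (- (d * (norm x)\<^sup>2)) \<le> ereal (- 2 * l * (norm x)\<^sup>2)"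
        using mult_right_mono[OF l(3), of "(norm x)\<^sup>2"] by simp
      also have "\<dots> \<le> Q f w x"
        by (rule Q_ge_if_supported) (rule supp)
      finally show ?thesis .
    qed
    ultimately show ?thesis by blast
  qed
  then show ?thesis
    by (rule SQPS_sequence_if_approximate)
qed

end
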